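(* For every integer $n\geq 3$, let $F_{2,n}$ be the graph obtained from the $4$-cycle $C_4$ by adding $n-2$ pendant edges at a single vertex of $C_4$ (so $F_{2,n}$ has $n+2$ vertices and $n+2$ edges). Then $$r_2(F_{2,n})=\begin{cases} 2n-1, & \text{if } n \text{ is even},\\ 2n, & \text{if } n \text{ is odd}.\end{cases}$$
   Context: For a graph $H$, the Ramsey number $r_2(H)$ is the minimum integer $N$ such that every coloring of the edges of the complete graph $K_N$ with $2$ colors contains a monochromatic copy of $H$ (a subgraph isomorphic to $H$ all of whose edges have the same color). *)

theory Defs
  imports "HOL-Library.Ramsey" "HOL-Library.FuncSet"
begin

record 'a graph =
  verts :: "'a set"
  edges :: "'a set set"

text \<open>\<^term>\<open>nsets V 2\<close> is the set of two-element subsets of \<^term>\<open>V\<close>, so there are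
  no loops and no multiple edges.\<close>

definition simple_graph :: "'a graph \<Rightarrow> bool" where
  "simple_graph G \<longleftrightarrow> edges G \<subseteq> nsets (verts G) 2"

definition subgraph_of :: "'a graph \<Rightarrow> 'a graph \<Rightarrow> bool" where
  "subgraph_of S G \<longleftrightarrow> simple_graph S \<and> verts S \<subseteq> verts G \<and> edges S \<subseteq> edges G"

definition isomorphic_graphs :: "'a graph \<Rightarrow> 'b graph \<Rightarrow> bool" where
  "isomorphic_graphs G H \<longleftrightarrow>
     (\<exists>f. bij_betw f (verts G) (verts H) \<and> edges H = (\<lambda>e. f ` e) ` edges G)"

definition complete_graph :: "nat \<Rightarrow> nat graph" where
  "complete_graph N = \<lparr>verts = {..<N}, edges = nsets {..<N} 2\<rparr>"

definition edge_coloring :: "nat \<Rightarrow> 'a graph \<Rightarrow> ('a set \<Rightarrow> nat) \<Rightarrow> bool" where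
  "edge_coloring k G c \<longleftrightarrow> c \<in> edges G \<rightarrow> {..<k}"

definition has_mono_copy :: "'a graph \<Rightarrow> ('a set \<Rightarrow> nat) \<Rightarrow> 'b graph \<Rightarrow> bool" where
  "has_mono_copy G c H \<longleftrightarrow>
     (\<exists>S. subgraph_of S G \<and> isomorphic_graphs H S \<and> (\<exists>i. \<forall>e\<in>edges S. c e = i))"

definition ramsey_number :: "nat \<Rightarrow> 'a graph \<Rightarrow> nat" where
  "ramsey_number k H =
     (LEAST N. \<forall>c. edge_coloring k (complete_graph N) c \<longrightarrow> has_mono_copy (complete_graph N) c H)"

text \<open>The 4-cycle is 0-1-2-3-0; the pendant edges join vertex 0 to the new vertices
  4, ..., n + 1.\<close>

definition F2 :: "nat \<Rightarrow> nat graph" where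
  "F2 n = \<lparr>verts = {0, 1, 2, 3} \<union> {4..<n + 2},
           edges = {{0, 1}, {1, 2}, {2, 3}, {3, 0}} \<union> {{0, v} | v. v \<in> {4..<n + 2}}\<rparr>"

lemma simple_graph_F2: "simple_graph (F2 n)"
  by (auto simp: simple_graph_def F2_def nsets_def)

lemma card_verts_F2:
  assumes "n \<ge> 2"
  shows "card (verts (F2 n)) = n + 2"
proof -
  have "verts (F2 n) = {..<n + 2}"
    using assms by (auto simp: F2_def)
  then show ?thesis by simp
qed

lemma card_edges_F2:
  assumes "n \<ge> 2"
  shows "card (edges (F2 n)) = n + 2"
proof -
  let ?C = "{{0, 1}, {1, 2}, {2, 3}, {3, 0}} :: nat set set"
  let ?P = "(\<lambda>v. {0, v}) ` {4..<n + 2}"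
  have C: "card ?C = 4"
    by (simp add: card_insert_if doubleton_eq_iff)
  have "inj_on (\<lambda>v::nat. {0, v}) {4..<n + 2}"
    by (rule inj_onI) (simp add: doubleton_eq_iff)
  then have P: "card ?P = n - 2"
    by (simp add: card_image)
  have "e \<notin> ?P" if "e \<in> ?C" for e
  proof -
    have "e \<subseteq> {0, 1, 2, 3}"
      using that by blast
    then show ?thesis by fastforce
  qed
  then have "?C \<inter> ?P = {}"
    by blast
  then have "card (?C \<union> ?P) = card ?C + card ?P"
    by (intro card_Un_disjoint) simp_all
  moreover note C P
  moreover have "edges (F2 n) = ?C \<union> ?P"
    by (simp only: F2_def graph.simps Setcompr_eq_image)
  ultimately have "card (edges (F2 n)) = 4 + (n - 2)"
    by (simp only:)
  then show ?thesis using assms by simp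
qed

end

theory Submission
  imports Defs
begin

text \<open>The lower bounds come from colorings in which every vertex has at most \<open>n - 1\<close> neighbors
  in each color: two disjoint cliques of size \<open>n - 1\<close>, and for odd \<open>n\<close> a circulant coloring
  of \<open>2 n - 1\<close> vertices. For the upper bounds, counting (and parity, if \<open>n\<close> is even) gives a
  vertex \<open>v\<close> with a set \<open>A\<close> of at least \<open>n\<close> red neighbors. Without a red copy, every
  blue neighbor of \<open>v\<close> has at most one red edge to \<open>A\<close>, so two blue neighbors of \<open>v\<close>
  already span a blue copy with \<open>v\<close> and \<open>A\<close>. If \<open>v\<close> has at most one blue neighbor, then
  \<open>A\<close> has more than \<open>n\<close> vertices and the red edges inside \<open>A\<close> form a matching;
  a blue copy is then centered at the blue neighbor of \<open>v\<close> if it exists, and at any vertex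
  of \<open>A\<close> otherwise.\<close>

section \<open>A monochromatic copy forced by one vertex of large degree\<close>

text \<open>\<open>v\<close> is the vertex of degree \<open>n\<close>, and \<open>w\<close> is opposite to it on the 4-cycle.\<close>

definition has_F2 :: "nat \<Rightarrow> 'a set \<Rightarrow> ('a \<Rightarrow> 'a \<Rightarrow> bool) \<Rightarrow> bool" where
  "has_F2 n V R \<longleftrightarrow> (\<exists>v\<in>V. \<exists>w\<in>V. v \<noteq> w \<and> n \<le> card {x \<in> V - {v, w}. R v x} \<and>
     2 \<le> card {x \<in> V - {v, w}. R v x \<and> R w x})"

lemma has_F2I:
  assumes "finite V" "v \<in> V" "w \<in> V" "v \<noteq> w"
    and "D \<subseteq> V - {v, w}" "\<And>x. x \<in> D \<Longrightarrow> R v x" "n \<le> card D"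
    and "C \<subseteq> D" "\<And>x. x \<in> C \<Longrightarrow> R w x" "2 \<le> card C"
  shows "has_F2 n V R"
proof -
  have "card D \<le> card {x \<in> V - {v, w}. R v x}"
    using assms by (intro card_mono) auto
  moreover have "card C \<le> card {x \<in> V - {v, w}. R v x \<and> R w x}"
    using assms by (intro card_mono) auto
  ultimately show ?thesis
    unfolding has_F2_def using assms by (meson le_trans)
qed

lemma card_filter_not:
  assumes "finite A"
  shows "card {x \<in> A. \<not> P x} = card A - card {x \<in> A. P x}"
proof -
  have "{x \<in> A. \<not> P x} = A - {x \<in> A. P x}"
    by auto
  then show ?thesis
    using assms by (simp add: card_Diff_subset)
qed

lemma has_F2_or_complement:
  assumes fin: "finite V" and sym: "symp R" and v: "v \<in> V" and n: "3 \<le> n"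
    and V: "n + 3 \<le> card V" and deg: "n \<le> card {u \<in> V - {v}. R v u}"
  shows "has_F2 n V R \<or> has_F2 n V (\<lambda>x y. \<not> R x y)"
  unfolding disj_imp
proof
  assume no: "\<not> has_F2 n V R"
  define A where "A = {u \<in> V - {v}. R v u}"
  define B where "B = {u \<in> V - {v}. \<not> R v u}"
  have finA: "finite A" and finB: "finite B" and AV: "A \<subseteq> V" and BV: "B \<subseteq> V"
    and vA: "v \<notin> A" "v \<notin> B" and AB: "A \<inter> B = {}"
    using fin by (auto simp: A_def B_def)
  have degA: "n \<le> card A"
    using deg by (simp only: A_def)
  have "V - {v} = A \<union> B"
    by (auto simp: A_def B_def)
  then have cardV: "card V = Suc (card A + card B)"
    by (metis AB card_Suc_Diff1 card_Un_disjoint fin finA finB v)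
  \<comment> \<open>With two red neighbors in \<open>A - {w}\<close>, \<open>w\<close> would be
    opposite to \<open>v\<close> in a red copy centered at \<open>v\<close>. As \<open>w\<close>
    then cannot be one of the \<open>n\<close> neighbors, \<open>n\<close> vertices must remain
    without it.\<close>
  have few: "card {x \<in> A - {w}. R w x} \<le> 1" if "w \<in> V - {v}" "n \<le> card (A - {w})" for w
  proof (rule ccontr)
    assume "\<not> ?thesis"
    then have "has_F2 n V R"
      using that v fin by (intro has_F2I[of V v w "A - {w}" R n "{x \<in> A - {w}. R w x}"])
        (auto simp: A_def)
    with no show False ..
  qed
  have fewB: "card {x \<in> A. R w x} \<le> 1" if "w \<in> B" for w
  proof -
    have "w \<in> V - {v}" "A - {w} = A"
      using that AB BV vA by auto
    then show ?thesis
      using few[of w] degA by simp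
  qed
  have vR: "\<not> R w v" if "w \<in> B" for w
    using that sympD[OF sym] by (auto simp: B_def)
  show "has_F2 n V (\<lambda>x y. \<not> R x y)"
  proof (cases "card B \<le> 1")
    case False
    then have "\<exists>w w'. w \<in> B \<and> w' \<in> B \<and> w \<noteq> w'"
      using card_le_Suc0_iff_eq[OF finB] by auto
    then obtain w w' where w: "w \<in> B" "w' \<in> B" "w \<noteq> w'"
      by blast
    \<comment> \<open>The blue copy has center \<open>w\<close> and opposite vertex
      \<open>w'\<close>. Each has at most one red neighbor in \<open>A\<close>; \<open>v\<close>,
      blue to both, makes up for the loss, raising \<open>n - 1\<close> to \<open>n\<close> in
      \<open>?D\<close> and \<open>n - 2 \<ge> 1\<close> to 2 in \<open>?C\<close>.\<close>
    let ?D = "{x \<in> A. \<not> R w x}" and ?C = "{x \<in> A. \<not> (R w x \<or> R w' x)}"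
    have "card A - 1 \<le> card ?D"
      using fewB[OF w(1)] finA by (simp add: card_filter_not)
    then have D: "n \<le> card (insert v ?D)"
      using degA finA vA by simp
    have "{x \<in> A. R w x \<or> R w' x} = {x \<in> A. R w x} \<union> {x \<in> A. R w' x}"
      by auto
    then have "card {x \<in> A. R w x \<or> R w' x} \<le> 2"
      using card_Un_le[of "{x \<in> A. R w x}" "{x \<in> A. R w' x}"] fewB[OF w(1)] fewB[OF w(2)]
      by simp
    then have "card A - 2 \<le> card ?C"
      using card_filter_not[OF finA, of "\<lambda>x. R w x \<or> R w' x"] by linarith
    then have C: "2 \<le> card (insert v ?C)"
      using degA n finA vA by simp
    show ?thesis
      by (rule has_F2I[of V w w' "insert v ?D" _ n "insert v ?C"])
        (use w C D fin v vA AV BV AB vR in auto)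
  next
    case True
    \<comment> \<open>Only \<open>v\<close> and at most one blue neighbor lie outside
      \<open>A\<close>. The spare vertex makes \<open>few\<close> applicable to vertices of
      \<open>A\<close> as well.\<close>
    have A: "n + 1 \<le> card A"
      using True V cardV by linarith
    have fewA: "card {x \<in> A - {w}. R w x} \<le> 1" if "w \<in> A" for w
      proof -
      have "w \<in> V - {v}"
        using that AV vA by blast
      then show ?thesis
        using few[of w] that A finA by simp
    qed
    show ?thesis
    proof (cases "B = {}")
      case False
      then obtain w where w: "w \<in> B"
        by blast
      \<comment> \<open>Take \<open>c\<close> as the only red neighbor of \<open>w\<close> in
        \<open>A\<close>, or any vertex of \<open>A\<close> if there is none. As the opposite vertex
        it leaves the neighborhood of the center \<open>w\<close>.\<close>
      have "\<exists>c\<in>A. \<forall>x\<in>A - {c}. \<not> R w x"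
      proof (cases "\<exists>c\<in>A. R w c")
        case True
        then show ?thesis
          using fewB[OF w] finA card_le_Suc0_iff_eq[of "{x \<in> A. R w x}"] by auto
      next
        case False
        moreover have "A \<noteq> {}"
          using A by auto
        ultimately show ?thesis
          by blast
      qed
      then obtain c where c: "c \<in> A" "\<forall>x\<in>A - {c}. \<not> R w x"
        by blast
      let ?C = "{x \<in> A - {c}. \<not> R c x}"
      have D: "n \<le> card (insert v (A - {c}))"
        using A c vA finA by simp
      \<comment> \<open>The edge from \<open>c\<close> to \<open>v\<close> is red, so both common
        neighbors must come from \<open>A - {c}\<close>, where \<open>c\<close> has at most one red
        neighbor.\<close>
      have C: "2 \<le> card ?C"
        using fewA[OF c(1)] card_filter_not[of "A - {c}" "R c"] A n c finA by simp
      show ?thesis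
        by (rule has_F2I[of V w c "insert v (A - {c})" _ n ?C])
          (use w c C D fin v vA AV BV AB vR in auto)
    next
      case True
      \<comment> \<open>Now \<open>v\<close> has no blue edge, so the copy must lie inside
        \<open>A\<close>: center \<open>w\<close>, opposite vertex \<open>c\<close>, and
        \<open>n\<close> further vertices.\<close>
      then have A: "n + 2 \<le> card A"
        using V cardV by simp
      then obtain w where w: "w \<in> A"
        by fastforce
      have "\<exists>c\<in>A - {w}. \<forall>x\<in>A - {w, c}. \<not> R w x"
      proof (cases "\<exists>c\<in>A - {w}. R w c")
        case True
        then show ?thesis
          using fewA[OF w] finA card_le_Suc0_iff_eq[of "{x \<in> A - {w}. R w x}"] by auto
      next
        case False
        moreover have "card (A - {w}) \<noteq> 0"
          using A w finA by simp
        then have "A - {w} \<noteq> {}"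
          by force
        ultimately show ?thesis
          by blast
      qed
      then obtain c where c: "c \<in> A - {w}" "\<forall>x\<in>A - {w, c}. \<not> R w x"
        by blast
      let ?C = "{x \<in> A - {w, c}. \<not> R c x}"
      have D: "n \<le> card (A - {w, c})"
        using A c w finA card_Diff_subset[of "{w, c}" A] by (auto simp: card_insert_if)
      have "card {x \<in> A - {w, c}. R c x} \<le> card {x \<in> A - {c}. R c x}"
        using finA by (intro card_mono) auto
      also have "\<dots> \<le> 1"
        using fewA c by blast
      finally have C: "2 \<le> card ?C"
        using card_filter_not[of "A - {w, c}" "R c"] D n finA by simp
      show ?thesis
        by (rule has_F2I[of V w c "A - {w, c}" _ n ?C]) (use w c C D fin AV in auto)
    qed
  qed
qed

section \<open>Degree counting and parity\<close>

text \<open>Handshake argument by induction: a new vertex \<open>x\<close> adds its own degree, and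
  by symmetry the degrees of the old vertices grow by the same total.\<close>

lemma even_sum_degrees:
  assumes "finite V" "symp R"
  shows "even (\<Sum>v\<in>V. card {u \<in> V - {v}. R v u})"
  using assms(1)
proof (induction V rule: finite_induct)
  case (insert x V)
  have step: "card {u \<in> insert x V - {v}. R v u} =
      card {u \<in> V - {v}. R v u} + of_bool (R v x)" if "v \<in> V" for v
  proof -
    have "{u \<in> insert x V - {v}. R v u} =
        (if R v x then insert x {u \<in> V - {v}. R v u} else {u \<in> V - {v}. R v u})"
      using that insert by auto
    then show ?thesis
      using insert by simp
  qed
  have "(\<Sum>v\<in>V. card {u \<in> insert x V - {v}. R v u}) =
      (\<Sum>v\<in>V. card {u \<in> V - {v}. R v u}) + (\<Sum>v\<in>V. of_bool (R v x))"
    by (simp only: step sum.distrib cong: sum.cong)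
  moreover have "(\<Sum>v\<in>V. of_bool (R v x)) = card {u \<in> V. R x u}"
    using insert sympD[OF assms(2)] by (simp add: sum.If_cases of_bool_def Int_def) metis
  moreover have "{u \<in> insert x V - {x}. R x u} = {u \<in> V. R x u}"
    using insert by auto
  ultimately have "(\<Sum>v\<in>insert x V. card {u \<in> insert x V - {v}. R v u}) =
      2 * card {u \<in> V. R x u} + (\<Sum>v\<in>V. card {u \<in> V - {v}. R v u})"
    by (simp only: sum.insert[OF insert.hyps] mult_2 add_ac)
  then show ?case
    using insert.IH by simp
qed simp

text \<open>If both degrees of every vertex were at most \<open>n - 1\<close>, there would be at
  most \<open>2 * n - 1\<close> vertices, and with equality \<open>R\<close> would be regular of
  degree \<open>n - 1\<close>. For even \<open>n\<close> both numbers are odd, against the handshake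
  argument.\<close>

lemma exists_large_degree:
  assumes "n \<ge> 1" "symp R" "finite V" "2 * n \<le> card V \<or> even n \<and> 2 * n - 1 = card V"
  shows "\<exists>v\<in>V. n \<le> card {u \<in> V - {v}. R v u} \<or> n \<le> card {u \<in> V - {v}. \<not> R v u}"
proof (rule ccontr)
  assume *: "\<not> ?thesis"
  have sum: "card {u \<in> V - {v}. R v u} + card {u \<in> V - {v}. \<not> R v u} = card V - 1"
    if "v \<in> V" for v
  proof -
    have "card {u \<in> V - {v}. R v u} \<le> card (V - {v})"
      using assms(3) by (intro card_mono) auto
    then show ?thesis
      using card_filter_not[of "V - {v}" "R v"] assms(3) that by simp
  qed
  show False
  proof (cases "2 * n \<le> card V")
    case True
    then have "V \<noteq> {}"
      using assms(1) by auto
    then obtain v where "v \<in> V"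
      by blast
    with * have "card {u \<in> V - {v}. R v u} < n" "card {u \<in> V - {v}. \<not> R v u} < n"
      by auto
    then show False
      using sum[OF \<open>v \<in> V\<close>] True by linarith
  next
    case False
    then have V: "even n" "card V = 2 * n - 1"
      using assms(4) by auto
    have "card {u \<in> V - {v}. R v u} = n - 1" if "v \<in> V" for v
    proof -
      have "card {u \<in> V - {v}. R v u} < n" "card {u \<in> V - {v}. \<not> R v u} < n"
        using * that by auto
      then show ?thesis
        using sum[OF that] V assms(1) by linarith
    qed
    then have "even ((2 * n - 1) * (n - 1))"
      using even_sum_degrees[OF assms(3,2)] V by simp
    then show False
      using V assms(1) by auto
  qed
qed

section \<open>Passing between copies of \<open>F2 n\<close> and neighbor counts\<close>

lemma has_F2_imp_mono_copy:
  assumes n: "n \<ge> 2" and F: "has_F2 n {..<N} (\<lambda>x y. c {x, y} = i)"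
  shows "has_mono_copy (complete_graph N) c (F2 n)"
proof -
  obtain v w where vw: "v \<in> {..<N}" "w \<in> {..<N}" "v \<noteq> w"
    and D0: "n \<le> card {x \<in> {..<N} - {v, w}. c {v, x} = i}" (is "n \<le> card ?D0")
    and C: "2 \<le> card {x \<in> {..<N} - {v, w}. c {v, x} = i \<and> c {w, x} = i}" (is "2 \<le> card ?C")
    using F unfolding has_F2_def by (elim bexE conjE) (rule that)
  obtain T where T: "T \<subseteq> ?C" "card T = 2"
    using obtain_subset_with_card_n[OF C] by blast
  then obtain a b where "T = {a, b}" "a \<noteq> b"
    using card_2_iff by metis
  with T have ab: "a \<in> ?C" "b \<in> ?C" "a \<noteq> b"
    by blast+
  \<comment> \<open>\<open>?D0\<close> already avoids \<open>w\<close>, so removing the cycle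
    vertices \<open>a\<close> and \<open>b\<close> leaves enough room for the \<open>n - 2\<close>
    pendant vertices.\<close>
  have "n - 2 \<le> card (?D0 - {a, b})"
    using D0 diff_card_le_card_Diff[of "{a, b}" ?D0] ab by simp
  then obtain P where P: "P \<subseteq> ?D0 - {a, b}" "card P = n - 2" "finite P"
    by (rule obtain_subset_with_card_n)
  then obtain g where g: "bij_betw g {4..<n + 2} P"
    using finite_same_card_bij[of "{4..<n + 2}" P] by auto
  define f where "f = g(0 := v, 1 := a, 2 := w, 3 := b)"
  have fg: "f x = g x" "f x \<in> P" if "4 \<le> x" "x < n + 2" for x
    using that bij_betw_apply[OF g] by (auto simp: f_def)
  have f4: "f 0 = v" "f (Suc 0) = a" "f 2 = w" "f 3 = b"
    by (simp_all add: f_def)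
  have "inj_on f {4..<n + 2}"
    using g fg by (auto simp: bij_betw_def inj_on_def)
  moreover have "inj_on f {0, 1, 2, 3}"
    using ab vw by (auto simp: inj_on_def f4)
  moreover have "f ` {4..<n + 2} \<subseteq> P"
    using fg by auto
  moreover have "v \<notin> P" "a \<notin> P" "w \<notin> P" "b \<notin> P"
    using P(1) by auto
  ultimately have "inj_on f {0, 1, 2, 3}" "inj_on f {4..<n + 2}"
      "f ` {0, 1, 2, 3} \<inter> f ` {4..<n + 2} = {}"
    by (auto simp: f4)
  then have inj: "inj_on f (verts (F2 n))"
    unfolding F2_def graph.simps by (subst inj_on_Un) blast
  define S where "S = \<lparr>verts = f ` verts (F2 n), edges = (`) f ` edges (F2 n)\<rparr>"
  have "isomorphic_graphs (F2 n) S"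
    unfolding isomorphic_graphs_def S_def using inj by (auto simp: bij_betw_def)
  moreover have vN: "f ` verts (F2 n) \<subseteq> {..<N}"
  proof -
    have "f x < N" if "4 \<le> x" "x < n + 2" for x
      using fg(2)[OF that] P(1) by blast
    then show ?thesis
      using ab vw by (auto simp: F2_def f4)
  qed
  have simple: "(`) f ` edges (F2 n) \<subseteq> nsets (f ` verts (F2 n)) 2"
  proof
    fix e assume "e \<in> (`) f ` edges (F2 n)"
    then obtain e' where e': "e = f ` e'" "e' \<in> nsets (verts (F2 n)) 2"
      using simple_graph_F2[of n] unfolding simple_graph_def by blast
    then have "inj_on f e'"
      using inj by (auto simp: nsets_def intro: inj_on_subset)
    with e' show "e \<in> nsets (f ` verts (F2 n)) 2"
      by (auto simp: nsets_def card_image)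
  qed
  have "subgraph_of S (complete_graph N)"
    using simple vN nsets_mono[OF vN, of 2]
    by (auto simp: subgraph_of_def simple_graph_def S_def complete_graph_def)
  moreover have "c e = i" if "e \<in> edges S" for e
  proof -
    have "c {v, f x} = i" if "x \<in> {4..<n + 2}" for x
      using fg(2)[of x] that P(1) by fastforce
    then show ?thesis
      using that ab by (auto simp: S_def F2_def f4 insert_commute)
  qed
  ultimately show ?thesis
    unfolding has_mono_copy_def by blast
qed

text \<open>Only the star at the center of the copy is kept; this suffices to exclude copies when
  all color degrees are below \<open>n\<close>.\<close>

lemma mono_copy_large_degree:
  assumes n: "n \<ge> 2" and copy: "has_mono_copy (complete_graph N) c (F2 n)"
  shows "\<exists>v<N. \<exists>i. n \<le> card {u \<in> {..<N} - {v}. c {v, u} = i}"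
proof -
  obtain S i where S: "subgraph_of S (complete_graph N)" "isomorphic_graphs (F2 n) S"
    and i: "\<And>e. e \<in> edges S \<Longrightarrow> c e = i"
    using copy unfolding has_mono_copy_def by blast
  obtain f where f: "bij_betw f (verts (F2 n)) (verts S)" "edges S = (`) f ` edges (F2 n)"
    using S(2) unfolding isomorphic_graphs_def by blast
  have sub: "verts S \<subseteq> {..<N}"
    using S(1) by (auto simp: subgraph_of_def complete_graph_def)
  let ?U = "{1, 3} \<union> {4..<n + 2}"
  have U: "insert 0 ?U \<subseteq> verts (F2 n)"
    by (auto simp: F2_def)
  then have inj: "inj_on f (insert 0 ?U)"
    using inj_on_subset[OF bij_betw_imp_inj_on[OF f(1)]] by blast
  have fN: "f x < N" if "x \<in> insert 0 ?U" for x
    using that U sub bij_betw_apply[OF f(1)] by blast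
  have "card ?U = 2 + (n - 2)"
    by (subst card_Un_disjoint) auto
  then have "n = card (f ` ?U)"
    using inj n by (simp add: card_image)
  also have "\<dots> \<le> card {u \<in> {..<N} - {f 0}. c {f 0, u} = i}"
  proof (rule card_mono)
    show "f ` ?U \<subseteq> {u \<in> {..<N} - {f 0}. c {f 0, u} = i}"
    proof
      fix y assume "y \<in> f ` ?U"
      then obtain x where x: "y = f x" "x \<in> ?U"
        by blast
      have "{0, x} \<in> edges (F2 n)"
        using x by (auto simp: F2_def insert_commute)
      then have "f ` {0, x} \<in> edges S"
        unfolding f(2) by (rule imageI)
      then have "c {f 0, y} = i"
        using i x by simp
      moreover have "y \<noteq> f 0"
        using inj_on_eq_iff[OF inj, of x 0] x by auto
      ultimately show "y \<in> {u \<in> {..<N} - {f 0}. c {f 0, u} = i}"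
        using x fN by auto
    qed
  qed simp
  finally show ?thesis
    using fN[of 0] by blast
qed

section \<open>The upper bound\<close>

lemma ramsey_upper:
  assumes n: "n \<ge> 3" and N: "N = (if even n then 2 * n - 1 else 2 * n)"
    and c: "edge_coloring 2 (complete_graph N) c"
  shows "has_mono_copy (complete_graph N) c (F2 n)"
proof -
  let ?R = "\<lambda>x y. c {x, y} = 0" and ?V = "{..<N}"
  have sym: "symp ?R" "symp (\<lambda>x y. \<not> ?R x y)"
    by (simp_all add: symp_def insert_commute)
  \<comment> \<open>For even \<open>n\<close>, the bound \<open>n + 3 \<le> 2 * n - 1\<close>
    requires \<open>n \<ge> 4\<close>.\<close>
  have "n \<noteq> 3" if "even n"
    using that by auto
  then have V: "n + 3 \<le> card ?V"
    using n N by (cases "even n") auto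
  have "2 * n \<le> card ?V \<or> even n \<and> 2 * n - 1 = card ?V"
    using N by simp
  then obtain v where v: "v \<in> ?V"
    "n \<le> card {u \<in> ?V - {v}. ?R v u} \<or> n \<le> card {u \<in> ?V - {v}. \<not> ?R v u}"
    using exists_large_degree[of n ?R ?V] n sym by auto
  then have "has_F2 n ?V ?R \<or> has_F2 n ?V (\<lambda>x y. \<not> ?R x y)"
    using has_F2_or_complement[of ?V ?R v n]
      has_F2_or_complement[of ?V "\<lambda>x y. \<not> ?R x y" v n] n V sym by auto
  \<comment> \<open>Not having color 0 means having color 1 only on edges; \<open>has_F2\<close>
    inspects only pairs of distinct vertices, which are edges here.\<close>
  moreover have "has_F2 n ?V (\<lambda>x y. c {x, y} = 1)" if "has_F2 n ?V (\<lambda>x y. \<not> ?R x y)"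
  proof -
    have "c {x, y} = 1" if "\<not> ?R x y" "x \<in> ?V" "y \<in> ?V" "x \<noteq> y" for x y
    proof -
      have "{x, y} \<in> edges (complete_graph N)"
        using that by (auto simp: complete_graph_def nsets_def)
      then have "c {x, y} < 2"
        using c by (auto simp: edge_coloring_def)
      then show ?thesis
        using that by simp
    qed
    then have "{x \<in> ?V - {v, w}. \<not> ?R v x} = {x \<in> ?V - {v, w}. c {v, x} = 1}"
        "{x \<in> ?V - {v, w}. \<not> ?R v x \<and> \<not> ?R w x} =
          {x \<in> ?V - {v, w}. c {v, x} = 1 \<and> c {w, x} = 1}" if "v \<in> ?V" "w \<in> ?V" for v w
      using that by fastforce+
    with that show ?thesis
      unfolding has_F2_def by (metis (no_types, lifting))
  qed
  ultimately show ?thesis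
    using has_F2_imp_mono_copy[of n N c] n by auto
qed

section \<open>The lower bounds\<close>

text \<open>Restricting a coloring of \<open>M\<close> vertices to the first \<open>N\<close> does
  not increase degrees, so one construction excludes all \<open>N \<le> M\<close> at once.\<close>

lemma ramsey_lower:
  assumes n: "n \<ge> 2" and sym: "symp R" and "N \<le> M"
    and deg: "\<And>v. v < M \<Longrightarrow> card {u \<in> {..<M} - {v}. R v u} < n"
      "\<And>v. v < M \<Longrightarrow> card {u \<in> {..<M} - {v}. \<not> R v u} < n"
  shows "\<exists>c. edge_coloring 2 (complete_graph N) c \<and> \<not> has_mono_copy (complete_graph N) c (F2 n)"
proof -
  define c :: "nat set \<Rightarrow> nat" where "c e = of_bool (\<exists>x y. e = {x, y} \<and> R x y)" for e
  have c: "c {x, y} = of_bool (R x y)" for x y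
    using sympD[OF sym] by (auto simp: c_def doubleton_eq_iff of_bool_def)
  have "edge_coloring 2 (complete_graph N) c"
    by (auto simp: edge_coloring_def c_def)
  moreover have "\<not> has_mono_copy (complete_graph N) c (F2 n)"
  proof
    assume "has_mono_copy (complete_graph N) c (F2 n)"
    then obtain v i where v: "v < N" "n \<le> card {u \<in> {..<N} - {v}. c {v, u} = i}"
      using mono_copy_large_degree[OF n] by blast
    have "v < M"
      using v \<open>N \<le> M\<close> by simp
    have "card {u \<in> {..<N} - {v}. c {v, u} = i} \<le> card {u \<in> {..<M} - {v}. R v u} \<or>
        card {u \<in> {..<N} - {v}. c {v, u} = i} \<le> card {u \<in> {..<M} - {v}. \<not> R v u}"
    \<comment> \<open>Color 1 encodes \<open>R\<close>; any other value \<open>i\<close> can occur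
      only where \<open>R\<close> fails.\<close>
    proof (cases "i = 1")
      case True
      then show ?thesis
        using \<open>N \<le> M\<close> by (intro disjI1 card_mono) (auto simp: c)
    next
      case False
      then show ?thesis
        using \<open>N \<le> M\<close> by (intro disjI2 card_mono) (auto simp: c)
    qed
    then show False
      using v deg[OF \<open>v < M\<close>] by linarith
  qed
  ultimately show ?thesis
    by blast
qed

lemma two_cliques_lower:
  assumes n: "n \<ge> 2" and N: "N \<le> 2 * (n - 1)"
  shows "\<exists>c. edge_coloring 2 (complete_graph N) c \<and> \<not> has_mono_copy (complete_graph N) c (F2 n)"
proof (rule ramsey_lower[where R = "\<lambda>x y. (x < n - 1) = (y < n - 1)", OF n _ N])
  fix v assume "v < 2 * (n - 1)"
  \<comment> \<open>Each color neighborhood of \<open>v\<close> lies within one of the two halves,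
    which have \<open>n - 1\<close> vertices each.\<close>
  have bound: "card X < n" if "X \<subseteq> {..<n - 1} \<or> X \<subseteq> {n - 1..<2 * (n - 1)}" for X
    using that card_mono[of "{..<n - 1}" X] card_mono[of "{n - 1..<2 * (n - 1)}" X] n by auto
  show "card {u \<in> {..<2 * (n - 1)} - {v}. (v < n - 1) = (u < n - 1)} < n"
    by (rule bound) auto
  show "card {u \<in> {..<2 * (n - 1)} - {v}. (v < n - 1) \<noteq> (u < n - 1)} < n"
    by (rule bound) auto
qed (auto simp: symp_def)

lemma circulant_lower:
  assumes n: "n = 2 * m + 1" "n \<ge> 2" and N: "N \<le> 4 * m + 1"
  shows "\<exists>c. edge_coloring 2 (complete_graph N) c \<and> \<not> has_mono_copy (complete_graph N) c (F2 n)"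
proof -
  define q where "q = int (4 * m + 1)"
  \<comment> \<open>Modulo \<open>q\<close>, \<open>K\<close> consists of \<open>1, ..., m\<close>
    and their negatives. Both \<open>K\<close> and the remaining nonzero residues have
    \<open>2 * m = n - 1\<close> elements.\<close>
  define K where "K = {1..int m} \<union> {3 * int m + 1..4 * int m}"
  \<comment> \<open>A vertex is determined by its difference to \<open>v\<close> modulo
    \<open>q\<close>, so the degree is at most the number of allowed differences.\<close>
  have card_diff: "card {u \<in> {..<4 * m + 1} - {v}. P u} < n"
    if sub: "\<And>u. u < 4 * m + 1 \<Longrightarrow> u \<noteq> v \<Longrightarrow> P u \<Longrightarrow> (int u - int v) mod q \<in> L"
      and L: "finite L" "card L < n" for v P L
  proof -
    have "inj_on (\<lambda>u. (int u - int v) mod q) {..<4 * m + 1}"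
    proof (rule inj_onI)
      fix x y assume xy: "x \<in> {..<4 * m + 1}" "y \<in> {..<4 * m + 1}"
        "(int x - int v) mod q = (int y - int v) mod q"
      then have "((int x - int v) mod q + int v) mod q = ((int y - int v) mod q + int v) mod q"
        by simp
      then have "int x mod q = int y mod q"
        by (simp only: mod_add_left_eq diff_add_cancel)
      then show "x = y"
        using xy by (simp add: q_def)
    qed
    then have "card {u \<in> {..<4 * m + 1} - {v}. P u} \<le> card L"
      using sub L by (intro card_inj_on_le[where f = "\<lambda>u. (int u - int v) mod q"])
        (auto intro: inj_on_subset)
    then show ?thesis
      using L by simp
  qed
  have neg: "(- z) mod q \<in> K" if "z mod q \<in> K" for z
    using that by (auto simp: zmod_zminus1_eq_if K_def q_def)
  show ?thesis
  proof (rule ramsey_lower[where R = "\<lambda>x y. (int y - int x) mod q \<in> K", OF n(2) _ N])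
    show "symp (\<lambda>x y. (int y - int x) mod q \<in> K)"
      proof (rule sympI)
      fix x y :: nat
      assume "(int y - int x) mod q \<in> K"
      from neg[OF this] show "(int x - int y) mod q \<in> K"
        by simp
    qed
  next
    fix v assume v: "v < 4 * m + 1"
    have "card K \<le> 2 * m"
      unfolding K_def by (rule order_trans[OF card_Un_le]) simp
    then show "card {u \<in> {..<4 * m + 1} - {v}. (int u - int v) mod q \<in> K} < n"
      using n by (intro card_diff[where L = K]) (auto simp: K_def)
    \<comment> \<open>The residue 0 is excluded by \<open>u \<noteq> v\<close>, so outside
      \<open>K\<close> only the middle block of residues is left.\<close>
    have "(int u - int v) mod q \<in> {int m + 1..3 * int m}"
      if "u < 4 * m + 1" "u \<noteq> v" "(int u - int v) mod q \<notin> K" for u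
    proof -
      define z where "z = (int u - int v) mod q"
      have "z \<noteq> 0"
      proof
        assume "z = 0"
        then have "int u mod q = int v mod q"
          by (simp add: z_def mod_eq_dvd_iff mod_0_imp_dvd)
        then show False
          using that v by (simp add: q_def)
      qed
      moreover have "0 \<le> z" "z < q"
        by (simp_all add: z_def q_def)
      ultimately show ?thesis
        using that(3) unfolding z_def[symmetric] by (auto simp: K_def q_def)
    qed
    then show "card {u \<in> {..<4 * m + 1} - {v}. (int u - int v) mod q \<notin> K} < n"
      using n by (intro card_diff[where L = "{int m + 1..3 * int m}"]) auto
  qed
qed

theorem theorem3p1:
  fixes n :: nat
  assumes "n \<ge> 3"
  shows "ramsey_number 2 (F2 n) = (if even n then 2 * n - 1 else 2 * n)"
  unfolding ramsey_number_def
proof (rule Least_equality)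
  show "\<forall>c. edge_coloring 2 (complete_graph (if even n then 2 * n - 1 else 2 * n)) c \<longrightarrow>
      has_mono_copy (complete_graph (if even n then 2 * n - 1 else 2 * n)) c (F2 n)"
    using ramsey_upper[OF assms refl] by blast
next
  fix N
  assume N: "\<forall>c. edge_coloring 2 (complete_graph N) c \<longrightarrow> has_mono_copy (complete_graph N) c (F2 n)"
  show "(if even n then 2 * n - 1 else 2 * n) \<le> N"
  proof (cases "even n")
    case True
    \<comment> \<open>Failure of the bound means \<open>N \<le> 2 * (n - 1)\<close>.\<close>
    then show ?thesis
      using two_cliques_lower[of n N] N assms by fastforce
  next
    case False
    then obtain m where "n = 2 * m + 1"
      by (rule oddE)
    \<comment> \<open>Here failure means \<open>N < 2 * n = 4 * m + 2\<close>, that is,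
      \<open>N \<le> 4 * m + 1\<close>.\<close>
    then show ?thesis
      using circulant_lower[of n m N] N assms by fastforce
  qed
qed

end
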